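(* Let $I$ be an index set with cardinality at most that of the continuum. Then there exists a family $\{X_\alpha\}_{\alpha\in I}$ of uniformly distributed random variables $X_\alpha:\Omega_\alpha\to[0,1]$, defined on probability spaces $\{(\Omega_\alpha,\mathcal{F}_\alpha,\mathbb{P}_\alpha)\}_{\alpha\in I}$, such that $X_\alpha(\Omega_\alpha)\cap X_\beta(\Omega_\beta)=\emptyset$ for all $\alpha,\beta\in I$ with $\alpha\neq\beta$.
   Context: $\mathcal{B}[0,1]$ denotes the Borel $\sigma$-algebra on $[0,1]$ and $\lambda$ denotes Lebesgue measure on $[0,1]$ restricted to Borel sets. A random variable $X:\Omega\to[0,1]$ on a probability space $(\Omega,\mathcal{F},\mathbb{P})$, i.e. a function measurable from $\mathcal{F}$ to $\mathcal{B}[0,1]$, is called uniformly distributed if $\mathbb{P}(X^{-1}(A))=\lambda(A)$ for all $A\in\mathcal{B}[0,1]$. Random variables may be defined on different probability spaces. $X(\Omega)$ denotes the image (range) of the function $X$. *)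

theory Defs
  imports "HOL-Probability.Probability" "HOL-Library.Equipollence"
begin

(* The Borel sigma-algebra on [0,1] with Lebesgue measure; it is lborel, not lebesgue,
   that is restricted, so exactly the Borel subsets of [0,1] are measurable. *)
definition unit_lborel :: "real measure" where
  "unit_lborel = restrict_space lborel {0..1}"

(* Measurability into unit_lborel includes that X maps the sample space into [0,1]. *)
definition uniformly_distributed :: "'a measure \<Rightarrow> ('a \<Rightarrow> real) \<Rightarrow> bool" where
  "uniformly_distributed M X \<longleftrightarrow>
     X \<in> measurable M unit_lborel \<and>
     (\<forall>A \<in> sets unit_lborel. emeasure M (X -` A \<inter> space M) = emeasure unit_lborel A)"

end

theory Submission
  imports Defs
begin

text \<open>
  The ranges are pairwise disjoint subsets of \<open>[0,1]\<close> that are thick, meaning that they meet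
  every Borel subset of \<open>[0,1]\<close> of positive measure; each of them carries the trace of Lebesgue
  measure, and the random variable on it is the inclusion into \<open>[0,1]\<close>.

  A thick set \<open>T\<close> has full outer measure, and \<open>T \<inter> A\<close> has the same outer measure as \<open>A\<close> for every
  measurable \<open>A\<close>. Hence the outer measure is countably additive on the trace sigma-algebra of \<open>T\<close>
  (\<open>emeasure_trace_measure\<close>), and the inclusion of \<open>T\<close> is uniformly distributed
  (\<open>uniform_on_thick\<close>).

  Continuum many disjoint thick sets come from Bernstein's construction
  (\<open>exists_disjoint_thick_family\<close>). By inner regularity it is enough that each set meets every
  compact \<open>K \<subseteq> [0,1]\<close> of positive measure. There are at most continuum many pairs \<open>(K, r)\<close> of such a
  \<open>K\<close> and a real \<open>r\<close> (\<open>closed_sets_lepoll_reals\<close>), and each \<open>K\<close> has at least continuum many points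
  (\<open>reals_lepoll_compact_pos\<close>). Transfinite recursion along a well-order of minimal type therefore
  picks pairwise distinct points \<open>c (K, r) \<in> K\<close> (\<open>injective_choice\<close>), and the sets
  \<open>T r = {c (K, r) | K}\<close> are disjoint and thick.
\<close>

section \<open>Cardinality\<close>

text \<open>
  A family of sets, each at least as large as the index set, has an injective choice function:
  along a well-order of the index set of minimal type, fewer than \<open>|J|\<close> points have been used at
  every stage.
\<close>
lemma injective_choice:
  includes cardinal_syntax
  fixes S :: "'j \<Rightarrow> 'a set"
  assumes "\<And>j. j \<in> J \<Longrightarrow> J \<lesssim> S j"
  shows "\<exists>c. inj_on c J \<and> (\<forall>j\<in>J. c j \<in> S j)"
proof -
  define r where "r = card_of J"
  have card_r: "Card_order r" and field_r: "Field r = J"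
    by (simp_all add: r_def card_of_card_order_on Field_card_of)
  from card_r have wo: "Well_order r" by (rule card_order_on_well_order_on)
  have wf: "wf (r - Id)"
    using wo by (simp add: well_order_on_def)
  define F where "F c j = (SOME x. x \<in> S j \<and> x \<notin> c ` underS r j)" for c :: "'j \<Rightarrow> 'a" and j
  define c where "c = wfrec (r - Id) F"
  have "adm_wf (r - Id) F"
    unfolding adm_wf_def
  proof (intro allI impI)
    fix f g :: "'j \<Rightarrow> 'a" and x
    assume "\<forall>z. (z, x) \<in> r - Id \<longrightarrow> f z = g z"
    then have "f ` underS r x = g ` underS r x"
      by (intro image_cong) (auto simp: underS_def)
    then show "F f x = F g x" by (simp add: F_def)
  qed
  with wf have "c = F c"
    unfolding c_def by (rule wfrec_fixpoint)
  then have rec: "c j = (SOME x. x \<in> S j \<and> x \<notin> c ` underS r j)" for j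
    unfolding F_def by (rule fun_cong)
  have c: "c j \<in> S j \<and> c j \<notin> c ` underS r j" if j: "j \<in> J" for j
  proof -
    have "\<not> S j \<subseteq> c ` underS r j"
    proof
      assume "S j \<subseteq> c ` underS r j"
      then have "S j \<lesssim> underS r j" by (auto simp: lepoll_iff)
      with assms[OF j] have "J \<lesssim> underS r j" by (rule lepoll_trans)
      then have "r \<le>o card_of (underS r j)"
        by (auto simp: r_def lepoll_def card_of_ordLeq)
      moreover have "card_of (underS r j) <o r"
        using card_of_underS[OF card_r] j field_r by auto
      ultimately show False
        using not_ordLess_ordLeq by blast
    qed
    then have "\<exists>x. x \<in> S j \<and> x \<notin> c ` underS r j" by blast
    then show ?thesis unfolding rec[of j] by (rule someI_ex)
  qed
  have "inj_on c J"
  proof (rule inj_onI, rule ccontr)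
    fix i j assume ij: "i \<in> J" "j \<in> J" "c i = c j" "i \<noteq> j"
    then have "(i, j) \<in> r \<or> (j, i) \<in> r"
      using wo field_r by (auto simp: well_order_on_def linear_order_on_def total_on_def)
    with ij have "i \<in> underS r j \<or> j \<in> underS r i"
      by (auto simp: underS_def)
    then show False
      using c[of i] c[of j] ij by (metis imageI)
  qed
  with c show ?thesis by blast
qed

text \<open>A closed set is determined by the members of a countable basis that it misses.\<close>
lemma closed_sets_lepoll_reals:
  "{K :: 'a :: second_countable_topology set. closed K} \<lesssim> (UNIV :: real set)"
proof -
  obtain B :: "'a set set" where B: "countable B" "topological_basis B"
    using ex_countable_basis by blast
  define code where
    "code K = {n. from_nat_into B n \<in> B \<and> from_nat_into B n \<inter> K = {}}" for K
  have sub: "K \<subseteq> L" if "code L \<subseteq> code K" "closed L" for K L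
  proof
    fix x assume x: "x \<in> K"
    show "x \<in> L"
    proof (rule ccontr)
      assume "x \<notin> L"
      then obtain U where U: "U \<in> B" "x \<in> U" "U \<subseteq> - L"
        using topological_basisE[OF B(2), of "- L" x] \<open>closed L\<close> by auto
      obtain n where n: "from_nat_into B n = U"
        using from_nat_into_surj[OF B(1) U(1)] by blast
      have "n \<in> code L" using U n by (auto simp: code_def)
      with \<open>code L \<subseteq> code K\<close> have "U \<inter> K = {}" using n by (auto simp: code_def)
      with U x show False by blast
    qed
  qed
  have "inj_on code {K. closed K}"
  proof (rule inj_onI)
    fix K L assume "K \<in> {K. closed K}" "L \<in> {K. closed K}" "code K = code L"
    then show "K = L" using sub[of K L] sub[of L K] by simp
  qed
  then have "{K :: 'a set. closed K} \<lesssim> (UNIV :: nat set set)"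
    unfolding lepoll_def by blast
  then show ?thesis
    using nat_sets_eqpoll_reals by (rule lepoll_trans2)
qed

text \<open>
  The function \<open>f t = \<lambda>(K \<inter> (-\<infinity>, t])\<close> is continuous and is constant on each interval that misses
  \<open>K\<close>. So the least \<open>t\<close> at which \<open>f\<close> takes a given value in \<open>(0, \<lambda>(K)]\<close> lies in \<open>K\<close>, and \<open>f\<close> maps
  \<open>K\<close> onto an interval. This direct argument makes the perfect set theorem unnecessary.
\<close>
lemma reals_lepoll_compact_pos:
  fixes K :: "real set"
  assumes K: "compact K" and pos: "emeasure lborel K > 0"
  shows "(UNIV :: real set) \<lesssim> K"
proof -
  define f where "f t = measure lborel (K \<inter> {..t})" for t
  define m where "m = measure lborel K"
  have fin: "emeasure lborel A < \<infinity>" if "A \<subseteq> K" "A \<in> sets borel" for A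
    using emeasure_mono[of A K lborel] emeasure_compact_finite[OF K] that K
    by (auto intro: le_less_trans simp: borel_compact)
  have mpos: "m > 0"
    using pos fin[of K] K by (simp add: m_def measure_def enn2real_positive_iff borel_compact)
  obtain a b where ab: "K \<subseteq> {a..b}"
    using bounded_subset_cbox_symmetric[OF compact_imp_bounded[OF K]] by (metis cbox_interval)
  have KB: "K \<in> sets borel" using K by (rule borel_compact)
  have step: "f t = f s + measure lborel (K \<inter> {s<..t})" if "s \<le> t" for s t
  proof -
    have "K \<inter> {..t} = (K \<inter> {..s}) \<union> (K \<inter> {s<..t})" using that by auto
    moreover have "measure lborel ((K \<inter> {..s}) \<union> (K \<inter> {s<..t})) = f s + measure lborel (K \<inter> {s<..t})"
      unfolding f_def using KB fin[of "K \<inter> {..s}"] fin[of "K \<inter> {s<..t}"]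
      by (intro measure_Union) (auto simp: less_top)
    ultimately show ?thesis by (simp add: f_def)
  qed
  have lip: "\<bar>f t - f s\<bar> \<le> \<bar>t - s\<bar>" for s t
  proof -
    have *: "\<bar>f t - f s\<bar> \<le> \<bar>t - s\<bar>" if "s \<le> t" for s t
    proof -
      have "measure lborel (K \<inter> {s<..t}) \<le> measure lborel {s<..t}"
        using KB that by (intro measure_mono_fmeasurable) (auto simp: fmeasurable_def)
      then show ?thesis using step[OF that] that by simp
    qed
    show ?thesis using *[of s t] *[of t s] by (cases "s \<le> t") (auto simp: abs_minus_commute)
  qed
  have cont: "continuous_on A f" for A
    by (rule lipschitz_on_continuous_on[of 1]) (auto simp: lipschitz_on_def dist_real_def lip)
  have "{0<..m} \<subseteq> f ` K"
  proof
    fix v assume v: "v \<in> {0<..m}"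
    \<comment> \<open>The interval starts at \<open>a - 1\<close>, to the left of \<open>K\<close>, so that \<open>f\<close> vanishes at its left end;
        \<open>max a b\<close> serves the case of an empty \<open>{a..b}\<close>.\<close>
    have KI: "K \<inter> {..a-1} = {}" "K \<inter> {..max a b} = K" using ab by fastforce+
    then have fa: "f (a - 1) = 0" and fb: "f (max a b) = m" by (auto simp: f_def m_def)
    define L where "L = {t \<in> {a-1..max a b}. f t = v}"
    have "\<exists>t. a - 1 \<le> t \<and> t \<le> max a b \<and> f t = v"
      using v fa fb by (intro IVT' cont) auto
    then have "L \<noteq> {}" by (auto simp: L_def)
    moreover have "compact L"
      unfolding compact_eq_bounded_closed L_def
      by (intro conjI continuous_closed_preimage_constant cont closed_atLeastAtMost
          bounded_subset[OF bounded_closed_interval[of "a - 1" "max a b"]]) auto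
    ultimately obtain t where t: "t \<in> L" "\<And>s. s \<in> L \<Longrightarrow> t \<le> s"
      using compact_attains_inf[of L] by blast
    have "t \<in> K"
    proof (rule ccontr)
      assume "t \<notin> K"
      then obtain e where e: "e > 0" "ball t e \<subseteq> - K"
        using openE[of "- K" t] compact_imp_closed[OF K] by (auto simp: open_Compl)
      have ta: "t > a - 1" using t(1) v fa by (cases "t = a - 1") (auto simp: L_def)
      define s where "s = max (a - 1) (t - e / 2)"
      have s: "s < t" "a - 1 \<le> s" using ta e(1) by (auto simp: s_def)
      have "{s<..t} \<subseteq> ball t e" using e(1) by (auto simp: s_def dist_real_def)
      then have "K \<inter> {s<..t} = {}" using e(2) by auto
      then have "f s = v" using step[of s t] s t(1) by (simp add: L_def)
      then have "s \<in> L" using s t(1) by (auto simp: L_def)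
      then show False using t(2) s by fastforce
    qed
    then show "v \<in> f ` K" using t(1) by (auto simp: L_def)
  qed
  then have "{0<..m} \<lesssim> K" by (auto simp: lepoll_iff)
  moreover have "(UNIV :: real set) \<approx> {0<..m}"
    by (rule eqpoll_sym, rule eqpoll_real_subset[of 0 m]) (use mpos in auto)
  ultimately show ?thesis by (rule lepoll_trans1[rotated])
qed

section \<open>The trace measure on a thick set\<close>

text \<open>
  \<open>T\<close> is thick if it meets every measurable set of positive measure. For a finite measure this says
  that \<open>T\<close> has full outer measure; \<open>T\<close> itself need not be measurable.
\<close>
definition thick :: "'a measure \<Rightarrow> 'a set \<Rightarrow> bool" where
  "thick N T \<longleftrightarrow> T \<subseteq> space N \<and> (\<forall>A \<in> sets N. A \<inter> T = {} \<longrightarrow> emeasure N A = 0)"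

text \<open>
  The outer measure of \<open>N\<close> on the trace sigma-algebra \<open>{T \<inter> A | A \<in> sets N}\<close>. In contrast,
  \<open>restrict_space N T\<close> has the same measurable sets for \<open>T \<subseteq> space N\<close>, but it takes its values from
  \<open>emeasure N\<close>, which is 0 on sets that are not measurable in \<open>N\<close>.
\<close>
definition trace_measure :: "'a measure \<Rightarrow> 'a set \<Rightarrow> 'a measure" where
  "trace_measure N T = measure_of T ((\<inter>) T ` sets N) (outer_measure_of N)"

lemma outer_measure_of_thick_Int:
  assumes T: "thick N T" and A: "A \<in> sets N"
  shows "outer_measure_of N (T \<inter> A) = emeasure N A"
proof (rule antisym)
  show "outer_measure_of N (T \<inter> A) \<le> emeasure N A"
    using outer_measure_of_mono[of "T \<inter> A" A N] A by simp
  show "emeasure N A \<le> outer_measure_of N (T \<inter> A)"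
    unfolding outer_measure_of_def
  proof (rule INF_greatest)
    fix E assume E: "E \<in> {E \<in> sets N. T \<inter> A \<subseteq> E}"
    then have "A - E \<in> sets N" "(A - E) \<inter> T = {}"
      using A by auto
    then have "emeasure N (A - E) = 0"
      using T by (simp add: thick_def)
    have "emeasure N A \<le> emeasure N (E \<union> (A - E))"
      using A E by (intro emeasure_mono) auto
    also have "\<dots> \<le> emeasure N E + emeasure N (A - E)"
      using A E by (intro emeasure_subadditive) auto
    finally show "emeasure N A \<le> emeasure N E"
      using \<open>emeasure N (A - E) = 0\<close> by simp
  qed
qed

lemma sets_trace_measure:
  assumes "T \<subseteq> space N"
  shows "sets (trace_measure N T) = (\<inter>) T ` sets N"
proof -
  have "sigma_algebra T ((\<inter>) T ` sets N)"
    using sets.sigma_algebra_axioms[of "restrict_space N T"] assms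
    by (simp add: sets_restrict_space space_restrict_space Int_absorb2)
  moreover have "(\<inter>) T ` sets N \<subseteq> Pow T" by auto
  ultimately show ?thesis
    by (simp add: trace_measure_def sigma_algebra.sigma_sets_eq)
qed

lemma space_trace_measure [simp]: "space (trace_measure N T) = T"
  unfolding trace_measure_def by (rule space_measure_of) auto

lemma emeasure_trace_measure:
  assumes T: "thick N T" and A: "A \<in> sets N"
  shows "emeasure (trace_measure N T) (T \<inter> A) = emeasure N A"
proof -
  let ?M = "trace_measure N T"
  have sets: "sets ?M = (\<inter>) T ` sets N"
    using T by (simp add: sets_trace_measure thick_def)
  have "emeasure ?M (T \<inter> A) = outer_measure_of N (T \<inter> A)"
  proof (rule emeasure_measure_of)
    show "trace_measure N T = measure_of T ((\<inter>) T ` sets N) (outer_measure_of N)"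
      by (rule trace_measure_def)
    show "positive (sets ?M) (outer_measure_of N)"
      by (simp add: positive_def)
    show "countably_additive (sets ?M) (outer_measure_of N)"
      unfolding countably_additive_def
    proof (intro allI impI)
      fix F :: "nat \<Rightarrow> 'a set"
      assume F: "range F \<subseteq> sets ?M" and disj: "disjoint_family F"
      have "\<forall>i. \<exists>B. B \<in> sets N \<and> F i = T \<inter> B" using F sets by blast
      then obtain B where B: "\<And>i. B i \<in> sets N" "\<And>i. F i = T \<inter> B i" by metis
      have DB: "disjointed B i \<in> sets N" for i
        using sets.range_disjointed_sets[of B N] B(1) by blast
      \<comment> \<open>The \<open>B i\<close> may overlap outside \<open>T\<close>; disjoint representatives have the same trace on \<open>T\<close>.\<close>
      have FD: "F i = T \<inter> disjointed B i" for i
      proof -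
        have "F i \<inter> B k = {}" if "k < i" for k
          using disjoint_family_onD[OF disj, of i k] that B(2)[of i] B(2)[of k] by auto
        then have "F i \<inter> (\<Union>k\<in>{0..<i}. B k) = {}" by fastforce
        then show ?thesis using B(2)[of i] unfolding disjointed_def by blast
      qed
      have "(\<Sum>i. outer_measure_of N (F i)) = (\<Sum>i. emeasure N (disjointed B i))"
        unfolding FD using outer_measure_of_thick_Int[OF T DB] by simp
      also have "\<dots> = emeasure N (\<Union>i. disjointed B i)"
        using DB by (intro suminf_emeasure disjoint_family_disjointed) auto
      also have "\<dots> = outer_measure_of N (T \<inter> (\<Union>i. disjointed B i))"
        using DB by (intro outer_measure_of_thick_Int[OF T, symmetric]) auto
      also have "T \<inter> (\<Union>i. disjointed B i) = (\<Union>i. F i)"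
        unfolding FD by blast
      finally show "(\<Sum>i. outer_measure_of N (F i)) = outer_measure_of N (\<Union>i. F i)" .
    qed
  qed (use A sets in auto)
  then show ?thesis using outer_measure_of_thick_Int[OF T A] by simp
qed

lemma space_unit_lborel [simp]: "space unit_lborel = {0..1}"
  by (simp add: unit_lborel_def space_restrict_space)

lemma emeasure_unit_lborel: "A \<subseteq> {0..1} \<Longrightarrow> emeasure unit_lborel A = emeasure lborel A"
  by (simp add: unit_lborel_def emeasure_restrict_space)

lemma sets_unit_lborel: "A \<in> sets unit_lborel \<longleftrightarrow> A \<in> sets borel \<and> A \<subseteq> {0..1}"
  by (auto simp: unit_lborel_def sets_restrict_space_iff)

lemma uniform_on_thick:
  assumes T: "thick unit_lborel T"
  shows "prob_space (trace_measure unit_lborel T)"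
    and "uniformly_distributed (trace_measure unit_lborel T) (\<lambda>x. x)"
proof -
  have sub: "T \<subseteq> {0..1}" using T by (simp add: thick_def)
  have "emeasure (trace_measure unit_lborel T) (T \<inter> {0..1}) = 1"
    using T by (subst emeasure_trace_measure) (auto simp: sets_unit_lborel emeasure_unit_lborel)
  then show "prob_space (trace_measure unit_lborel T)"
    using sub by (intro prob_spaceI) (simp add: Int_absorb2)
  have "(\<lambda>x. x) \<in> measurable (trace_measure unit_lborel T) unit_lborel"
    using sub by (intro measurableI) (auto simp: sets_trace_measure)
  then show "uniformly_distributed (trace_measure unit_lborel T) (\<lambda>x. x)"
    unfolding uniformly_distributed_def
    using emeasure_trace_measure[OF T] by (simp add: Int_commute)
qed

section \<open>Disjoint thick sets\<close>

lemma compact_pos_subset: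
  fixes A :: "'a :: euclidean_space set"
  assumes A: "A \<in> sets borel" "bounded A" and pos: "emeasure lborel A > 0"
  obtains K where "compact K" "K \<subseteq> A" "emeasure lborel K > 0"
proof -
  have "emeasure lborel A < \<infinity>" using A(2) by (rule emeasure_bounded_finite)
  then obtain e where e: "emeasure lborel A = ennreal e" "e > 0"
    using pos by (cases "emeasure lborel A") auto
  have "A \<in> sets lebesgue" using A(1) by simp
  then obtain K where K: "closed K" "K \<subseteq> A" "emeasure lebesgue (A - K) < ennreal e"
    using sets_lebesgue_inner_closed[of A e] e(2) by metis
  have sets: "K \<in> sets lborel" "A - K \<in> sets lborel"
    using A(1) borel_closed[OF K(1)] by auto
  have small: "emeasure lborel (A - K) < ennreal e"
    using K(3) sets(2) by simp
  have "emeasure lborel K \<noteq> 0"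
  proof
    assume null: "emeasure lborel K = 0"
    have "(A - K) \<union> K = A" using K(2) by blast
    then have "emeasure lborel A \<le> emeasure lborel (A - K) + emeasure lborel K"
      using emeasure_subadditive[OF sets(2,1)] by metis
    then have "ennreal e \<le> emeasure lborel (A - K)"
      unfolding e(1) null by (metis add_0_right)
    with small show False by (meson leD)
  qed
  then have "emeasure lborel K > 0" by (simp add: zero_less_iff_neq_zero)
  moreover have "compact K"
    unfolding compact_eq_bounded_closed using K(1) bounded_subset[OF A(2) K(2)] by (rule conjI[rotated])
  ultimately show thesis using K(2) by (intro that)
qed

text \<open>Bernstein's construction.\<close>
lemma exists_disjoint_thick_family:
  "\<exists>T :: real \<Rightarrow> real set. (\<forall>r. thick unit_lborel (T r)) \<and> disjoint_family T"
proof -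
  define \<K> where "\<K> = {K :: real set. compact K \<and> K \<subseteq> {0..1} \<and> emeasure lborel K > 0}"
  define J where "J = \<K> \<times> (UNIV :: real set)"
  have "\<K> \<lesssim> (UNIV :: real set)"
    by (rule lepoll_trans[OF subset_imp_lepoll closed_sets_lepoll_reals])
       (auto simp: \<K>_def compact_imp_closed)
  then have "J \<lesssim> (UNIV :: real set) \<times> (UNIV :: real set)"
    unfolding J_def by (intro times_lepoll_mono) auto
  moreover have "(UNIV :: real set) \<times> (UNIV :: real set) \<approx> (UNIV :: real set)"
    unfolding eqpoll_iff_card_of_ordIso
    by (rule card_of_Times_same_infinite) (rule infinite_UNIV_char_0)
  ultimately have J: "J \<lesssim> (UNIV :: real set)" by (rule lepoll_trans2)
  have "\<exists>c. inj_on c J \<and> (\<forall>j\<in>J. c j \<in> fst j)"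
  proof (rule injective_choice)
    fix j assume "j \<in> J"
    then have "(UNIV :: real set) \<lesssim> fst j"
      by (intro reals_lepoll_compact_pos) (auto simp: J_def \<K>_def)
    with J show "J \<lesssim> fst j" by (rule lepoll_trans)
  qed
  then obtain c where inj: "inj_on c J" and c: "\<And>j. j \<in> J \<Longrightarrow> c j \<in> fst j" by blast
  define T where "T r = (\<lambda>K. c (K, r)) ` \<K>" for r
  have "thick unit_lborel (T r)" for r
    unfolding thick_def
  proof (intro conjI ballI impI)
    show "T r \<subseteq> space unit_lborel"
    proof
      fix x assume "x \<in> T r"
      then obtain K where "K \<in> \<K>" "x = c (K, r)" by (auto simp: T_def)
      then show "x \<in> space unit_lborel" using c[of "(K, r)"] by (auto simp: J_def \<K>_def)
    qed
    fix A assume A: "A \<in> sets unit_lborel" "A \<inter> T r = {}"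
    show "emeasure unit_lborel A = 0"
    proof (rule ccontr)
      assume "emeasure unit_lborel A \<noteq> 0"
      then have "emeasure lborel A > 0" "A \<in> sets borel" "A \<subseteq> {0..1}"
        using A(1) by (auto simp: sets_unit_lborel emeasure_unit_lborel zero_less_iff_neq_zero)
      moreover from this have "bounded A" using bounded_closed_interval bounded_subset by blast
      ultimately obtain K where "compact K" "K \<subseteq> A" "emeasure lborel K > 0"
        using compact_pos_subset[of A] by blast
      then have "K \<in> \<K>" using \<open>A \<subseteq> {0..1}\<close> by (auto simp: \<K>_def)
      then have "c (K, r) \<in> A \<inter> T r"
        using c[of "(K, r)"] \<open>K \<subseteq> A\<close> by (auto simp: J_def T_def)
      then show False using A(2) by blast
    qed
  qed
  moreover have "disjoint_family T"
    unfolding disjoint_family_on_def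
  proof (intro ballI impI)
    fix r s :: real assume "r \<noteq> s"
    then have "c (K, r) \<noteq> c (L, s)" if "K \<in> \<K>" "L \<in> \<K>" for K L
      using inj_onD[OF inj, of "(K, r)" "(L, s)"] that by (auto simp: J_def)
    then show "T r \<inter> T s = {}" by (auto simp: T_def)
  qed
  ultimately show ?thesis by blast
qed

theorem theorem4:
  fixes I :: "'i set"
  assumes "I \<lesssim> (UNIV :: real set)"
  shows "\<exists>(M :: 'i \<Rightarrow> real measure) (X :: 'i \<Rightarrow> real \<Rightarrow> real).
           (\<forall>\<alpha>\<in>I. prob_space (M \<alpha>) \<and> uniformly_distributed (M \<alpha>) (X \<alpha>)) \<and>
           (\<forall>\<alpha>\<in>I. \<forall>\<beta>\<in>I. \<alpha> \<noteq> \<beta> \<longrightarrow>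
              X \<alpha> ` space (M \<alpha>) \<inter> X \<beta> ` space (M \<beta>) = {})"
proof -
  obtain g :: "'i \<Rightarrow> real" where g: "inj_on g I"
    using assms by (auto simp: lepoll_def)
  obtain T :: "real \<Rightarrow> real set" where T: "\<And>r. thick unit_lborel (T r)" "disjoint_family T"
    using exists_disjoint_thick_family by blast
  show ?thesis
  proof (intro exI conjI ballI impI)
    fix \<alpha> assume "\<alpha> \<in> I"
    show "prob_space (trace_measure unit_lborel (T (g \<alpha>)))"
      and "uniformly_distributed (trace_measure unit_lborel (T (g \<alpha>))) (\<lambda>x. x)"
      using uniform_on_thick[OF T(1)] by auto
  next
    fix \<alpha> \<beta> assume "\<alpha> \<in> I" "\<beta> \<in> I" "\<alpha> \<noteq> \<beta>"
    then have "T (g \<alpha>) \<inter> T (g \<beta>) = {}"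
      using g disjoint_family_onD[OF T(2)] by (auto dest: inj_onD)
    then show "(\<lambda>x. x) ` space (trace_measure unit_lborel (T (g \<alpha>))) \<inter>
        (\<lambda>x. x) ` space (trace_measure unit_lborel (T (g \<beta>))) = {}"
      by simp
  qed
qed
end
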